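(* Let $G$ be a grid graph, that is, a connected induced subgraph of the infinite 2-dimensional grid $P_\infty \square P_\infty$, whose vertex set is identified with $\mathbb{Z}^2$, and let $f|_G : V(G)\to\mathbb{R}^2$ be the restriction to $G$ of the natural labeling $f$ of the grid. If $G$ contains $P_3\square P_3$ as a subgraph and $f|_G$ is a monotone-geodesic labeling of $G$, then $\operatorname{gp}(G)=4$.
   Context: The distance $d_G(u,v)$ is the number of edges on a shortest $u,v$-path in $G$; a geodesic is a shortest path. A set $S\subseteq V(G)$ is a general position set of $G$ if no three distinct vertices of $S$ lie on a common geodesic of $G$. The general position number $\operatorname{gp}(G)$ is the maximum cardinality of a general position set of $G$. The Cartesian product $G\square H$ has vertex set $V(G)\times V(H)$, with $(g,h)$ and $(g',h')$ adjacent if either $g=g'$ and $hh'\in E(H)$, or $h=h'$ and $gg'\in E(G)$. $P_n$ is the path on $n$ vertices. $P_\infty$ is the two-way infinite path with vertices $v_i$, $i\in\mathbb{Z}$, where $v_i$ and $v_j$ are adjacent iff $|i-j|=1$. The natural labeling of $P_\infty\square P_\infty$ is $f(v_i,v_j)=(i,j)\in\mathbb{R}^2$. A sequence of real numbers is monotone if it is monotonically increasing or monotonically decreasing (in the weak sense, equalities allowed). A sequence $((x_1,y_1),\ldots,(x_k,y_k))$ of points of $\mathbb{R}^2$ is monotone if both sequences $(x_1,\ldots,x_k)$ and $(y_1,\ldots,y_k)$ are monotone (one may be increasing and the other decreasing). An injective map $h:V(G)\to\mathbb{R}^2$ is a monotone-geodesic labeling of $G$ if, whenever $x,y,z$ are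 vertices of $G$ such that the sequence $(h(x),h(y),h(z))$ is monotone, the vertices $x,y,z$ lie on a common geodesic of $G$. *)

theory Defs
  imports "Graph_Theory.Graph_Theory" "HOL-Library.Extended_Nat"
begin

text \<open>
  A simple undirected graph is represented, as usual in \<open>Graph_Theory\<close>, by a symmetric
  loop-free digraph without parallel arcs, so that each edge is a pair of opposite arcs and the
  number of edges of a path is the length of its arc list. Graphs may be infinite.
\<close>

section \<open>Geodesics and general position\<close>

definition geodesic :: "('a, 'b) pre_digraph \<Rightarrow> 'a \<Rightarrow> 'b awalk \<Rightarrow> 'a \<Rightarrow> bool" where
  "geodesic G u p v \<longleftrightarrow> pre_digraph.apath G u p v \<and>
     (\<forall>q. pre_digraph.apath G u q v \<longrightarrow> length p \<le> length q)"

definition on_common_geodesic :: "('a, 'b) pre_digraph \<Rightarrow> 'a set \<Rightarrow> bool" where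
  "on_common_geodesic G X \<longleftrightarrow>
     (\<exists>u p v. geodesic G u p v \<and> X \<subseteq> set (pre_digraph.awalk_verts G u p))"

definition general_position :: "('a, 'b) pre_digraph \<Rightarrow> 'a set \<Rightarrow> bool" where
  "general_position G S \<longleftrightarrow> S \<subseteq> verts G \<and>
     (\<forall>x\<in>S. \<forall>y\<in>S. \<forall>z\<in>S. distinct [x, y, z] \<longrightarrow> \<not> on_common_geodesic G {x, y, z})"

text \<open>
  The value is an extended natural number because \<open>G\<close> may be infinite. The empty set is in general
  position, and a nonempty set of extended naturals with finite supremum attains it; hence
  \<open>gp_number G = enat k\<close> says that \<open>k\<close> is the maximum cardinality of a general position set.
\<close>
definition gp_number :: "('a, 'b) pre_digraph \<Rightarrow> enat" where
  "gp_number G = (SUP S\<in>{S. general_position G S}. if finite S then enat (card S) else \<infinity>)"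

section \<open>Paths, Cartesian products and grid graphs\<close>

definition path_graph :: "nat \<Rightarrow> nat pair_pre_digraph" where
  "path_graph n = \<lparr> pverts = {..<n},
     parcs = {(i, j). i < n \<and> j < n \<and> (j = Suc i \<or> i = Suc j)} \<rparr>"

definition infinite_path :: "int pair_pre_digraph" where
  "infinite_path = \<lparr> pverts = UNIV, parcs = {(i, j). \<bar>i - j\<bar> = 1} \<rparr>"

definition cartesian_product ::
    "'a pair_pre_digraph \<Rightarrow> 'b pair_pre_digraph \<Rightarrow> ('a \<times> 'b) pair_pre_digraph"
    (infixr \<open>\<box>\<close> 70) where
  "G \<box> H = \<lparr> pverts = pverts G \<times> pverts H,
     parcs = {((g, h), (g', h')).
       (g = g' \<and> g \<in> pverts G \<and> (h, h') \<in> parcs H) \<or>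
       (h = h' \<and> h \<in> pverts H \<and> (g, g') \<in> parcs G)} \<rparr>"

definition grid_graph :: "(int \<times> int) pair_pre_digraph \<Rightarrow> bool" where
  "grid_graph G \<longleftrightarrow>
     induced_subgraph (with_proj G) (with_proj (infinite_path \<box> infinite_path)) \<and>
     Digraph_Component.connected (with_proj G)"

text \<open>``Contains as a subgraph'' is meant up to isomorphism.\<close>
definition contains_subgraph :: "'a pair_pre_digraph \<Rightarrow> 'b pair_pre_digraph \<Rightarrow> bool" where
  "contains_subgraph G K \<longleftrightarrow>
     (\<exists>H. subgraph (with_proj H) (with_proj G) \<and> digraph_iso (with_proj K) (with_proj H))"

section \<open>Monotone-geodesic labelings\<close>

definition monotone_seq :: "real list \<Rightarrow> bool" where
  "monotone_seq xs \<longleftrightarrow> sorted_wrt (\<le>) xs \<or> sorted_wrt (\<ge>) xs"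

definition monotone_points :: "(real \<times> real) list \<Rightarrow> bool" where
  "monotone_points ps \<longleftrightarrow> monotone_seq (map fst ps) \<and> monotone_seq (map snd ps)"

text \<open>Only the values of \<open>h\<close> on the vertices of \<open>G\<close> matter, so restrictions stay implicit.\<close>
definition monotone_geodesic_labeling ::
    "('a, 'b) pre_digraph \<Rightarrow> ('a \<Rightarrow> real \<times> real) \<Rightarrow> bool" where
  "monotone_geodesic_labeling G h \<longleftrightarrow> inj_on h (verts G) \<and>
     (\<forall>x\<in>verts G. \<forall>y\<in>verts G. \<forall>z\<in>verts G.
        monotone_points [h x, h y, h z] \<longrightarrow> on_common_geodesic G {x, y, z})"

definition natural_labeling :: "int \<times> int \<Rightarrow> real \<times> real" where
  "natural_labeling = (\<lambda>(i, j). (real_of_int i, real_of_int j))"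

end

theory Submission
  imports Defs
begin

text \<open>
  Few vertices suffice for either bound: five for the upper one, a star for the lower one.

  Upper bound. Order five vertices by the first coordinate of their labels. By the theorem of
  Erdos and Szekeres the second coordinates, listed in this order, contain a monotone subsequence
  of length three, so three of the labels form a monotone sequence. For a monotone-geodesic
  labeling the corresponding vertices lie on a common geodesic. Hence no set of five vertices is in
  general position, whatever the graph is (\<open>general_position_card_le_4\<close>).

  Lower bound. The centre of \<open>P\<^sub>3 \<box> P\<^sub>3\<close> has four neighbours. Seen in \<open>G\<close>, these are neighbours of
  a common vertex, and no two of them are adjacent, because the grid is bipartite. So any two of
  them are at distance exactly two. If three vertices occur on a geodesic, then the largest of their
  three distances is the sum of the other two; as \<open>2 \<noteq> 2 + 2\<close>, the four neighbours are in general
  position (\<open>general_position_neighbours\<close>).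
\<close>

section \<open>At most four vertices are in general position\<close>

text \<open>
  The case of the Erdos--Szekeres theorem for weakly monotone triples. Five is optimal, as the
  sequence 2, 1, 4, 3 shows.
\<close>
lemma monotone_triple_of_five:
  fixes f :: "nat \<Rightarrow> 'a::linorder"
  shows "\<exists>i j k. i < j \<and> j < k \<and> k < 5 \<and>
    (f i \<le> f j \<and> f j \<le> f k \<or> f i \<ge> f j \<and> f j \<ge> f k)"
proof (rule ccontr)
  assume "\<not> ?thesis"
  then have no: "\<not> (f i \<le> f j \<and> f j \<le> f k)" "\<not> (f i \<ge> f j \<and> f j \<ge> f k)"
    if "i < j" "j < k" "k < 5" for i j k
    using that by blast+
  \<comment> \<open>If \<open>f 0 \<le> f 1\<close>, all later values lie below \<open>f 1\<close>; to avoid a decreasing triple starting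
    with \<open>f 1\<close>, the values \<open>f 2, f 3, f 4\<close> must increase. The other case is dual.\<close>
  show False
  proof (cases "f 0 \<le> f 1")
    case True
    then have below: "f 2 < f 1" "f 3 < f 1"
      using no(1)[of 0 1 2] no(1)[of 0 1 3] by auto
    then have "f 2 < f 3" "f 3 < f 4"
      using no(2)[of 1 2 3] no(2)[of 1 3 4] by auto
    then show False
      using no(1)[of 2 3 4] by auto
  next
    case False
    then have above: "f 1 < f 2" "f 1 < f 3"
      using no(2)[of 0 1 2] no(2)[of 0 1 3] by auto
    then have "f 3 < f 2" "f 4 < f 3"
      using no(1)[of 1 2 3] no(1)[of 1 3 4] by auto
    then show False
      using no(2)[of 2 3 4] by auto
  qed
qed

lemma general_position_card_le_4:
  assumes lab: "monotone_geodesic_labeling G h" and gp: "general_position G S"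
  shows "finite S \<and> card S \<le> 4"
proof (rule ccontr)
  assume "\<not> (finite S \<and> card S \<le> 4)"
  then have "infinite S \<or> 5 \<le> card S"
    by linarith
  then obtain T where T: "T \<subseteq> S" "card T = 5" "finite T"
    using infinite_arbitrarily_large[of S 5] obtain_subset_with_card_n[of 5 S] by metis
  obtain ys where ys: "set ys = T" "distinct ys"
    using \<open>finite T\<close> finite_distinct_list by blast
  \<comment> \<open>Vertices with equal first coordinate may come in any order: monotonicity is weak.\<close>
  define xs where "xs = sort_key (fst \<circ> h) ys"
  have xs: "set xs = T" "distinct xs" "length xs = 5"
    using ys T(2) distinct_card[of ys] by (simp_all add: xs_def)
  have sorted: "sorted (map (fst \<circ> h) xs)"
    unfolding xs_def by (rule sorted_sort_key)
  obtain i j k where ijk: "i < j" "j < k" "k < 5"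
    and y: "snd (h (xs ! i)) \<le> snd (h (xs ! j)) \<and> snd (h (xs ! j)) \<le> snd (h (xs ! k)) \<or>
      snd (h (xs ! i)) \<ge> snd (h (xs ! j)) \<and> snd (h (xs ! j)) \<ge> snd (h (xs ! k))"
    using monotone_triple_of_five[of "\<lambda>i. snd (h (xs ! i))"] by metis
  have "fst (h (xs ! i)) \<le> fst (h (xs ! j))" "fst (h (xs ! j)) \<le> fst (h (xs ! k))"
    using sorted_nth_mono[OF sorted, of i j] sorted_nth_mono[OF sorted, of j k] ijk xs(3)
    by simp_all
  with y have mono: "monotone_points [h (xs ! i), h (xs ! j), h (xs ! k)]"
    by (auto simp: monotone_points_def monotone_seq_def)
  have "xs ! n \<in> S" if "n < 5" for n
    using that nth_mem[of n xs] xs T(1) by auto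
  then have in_S: "xs ! i \<in> S" "xs ! j \<in> S" "xs ! k \<in> S"
    using ijk by simp_all
  have dist: "distinct [xs ! i, xs ! j, xs ! k]"
    using ijk xs by (simp add: nth_eq_iff_index_eq)
  have "S \<subseteq> verts G"
    using gp by (simp add: general_position_def)
  then have "on_common_geodesic G {xs ! i, xs ! j, xs ! k}"
    using lab mono in_S by (simp add: monotone_geodesic_labeling_def subset_iff)
  moreover have "\<not> on_common_geodesic G {xs ! i, xs ! j, xs ! k}"
    using gp in_S dist by (simp add: general_position_def)
  ultimately show False
    by simp
qed

section \<open>Distances along a geodesic\<close>

context wf_digraph
begin

lemma awalk_to_apath_length_le:
  assumes "awalk u p v"
  shows "length (awalk_to_apath p) \<le> length p"
proof -
  have "awalk_cost (\<lambda>_. 1) es = real (length es)" for es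
    by (induct es) simp_all
  then show ?thesis
    using awalk_to_path_no_neg_cyc_cost[OF assms, of "\<lambda>_. 1"] by simp
qed

lemma awalk_take_drop:
  assumes "awalk u p v" and "i \<le> length p"
  shows "awalk u (take i p) (awalk_verts u p ! i)" and "awalk (awalk_verts u p ! i) (drop i p) v"
proof -
  have "awlast u (take i p) = awalk_verts u p ! i"
    using assms by (subst awalk_verts_take_conv[of u p v])
      (auto simp: length_awalk_verts take_Suc_conv_app_nth)
  moreover have "awalk u (take i p @ drop i p) v"
    using assms by simp
  ultimately show "awalk u (take i p) (awalk_verts u p ! i)"
    and "awalk (awalk_verts u p ! i) (drop i p) v"
    unfolding awalk_append_iff by auto
qed

text \<open>
  A walk shorter than the stretch between two vertices of a geodesic would be a shortcut for the
  whole geodesic. The shortened walk may repeat vertices, but it contains a path.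
\<close>
lemma geodesic_segment_le:
  assumes geo: "geodesic G u p v" and ij: "i \<le> j" "j \<le> length p"
    and q: "awalk (awalk_verts u p ! i) q (awalk_verts u p ! j)"
  shows "j - i \<le> length q"
proof -
  have p: "awalk u p v"
    using geo by (simp add: geodesic_def apath_def)
  let ?r = "take i p @ q @ drop j p"
  have "awalk u ?r v"
    using awalk_take_drop[OF p] ij q by (meson awalk_appendI le_trans)
  then have "apath u (awalk_to_apath ?r) v" "length (awalk_to_apath ?r) \<le> length ?r"
    by (rule apath_awalk_to_apath, rule awalk_to_apath_length_le)
  then have "length p \<le> length ?r"
    using geo unfolding geodesic_def by (meson le_trans)
  then show ?thesis
    using ij by simp
qed

lemma awalk_verts_consecutive:
  assumes p: "awalk u p v" and i: "i < length p"
  shows "awalk_verts u p ! i \<rightarrow> awalk_verts u p ! Suc i"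
proof -
  have "awalk (awalk_verts u p ! i) (p ! i # drop (Suc i) p) v"
    using awalk_take_drop(2)[OF p, of i] i by (simp add: Cons_nth_drop_Suc)
  then have e: "p ! i \<in> arcs G" "tail G (p ! i) = awalk_verts u p ! i"
    and "awalk (head G (p ! i)) (drop (Suc i) p) v"
    by (simp_all add: awalk_Cons_iff)
  moreover have "awalk (awalk_verts u p ! Suc i) (drop (Suc i) p) v"
    using awalk_take_drop(2)[OF p, of "Suc i"] i by simp
  ultimately have "head G (p ! i) = awalk_verts u p ! Suc i"
    using awalk_ends by blast
  with e show ?thesis
    using in_arcs_imp_in_arcs_ends[of "p ! i"] by simp
qed

lemma geodesic_positions_of_neighbours:
  assumes geo: "geodesic G u p v" and ij: "i < j" "j \<le> length p"
    and w: "awalk_verts u p ! i \<rightarrow> w" "w \<rightarrow> awalk_verts u p ! j"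
    and nadj: "\<not> awalk_verts u p ! i \<rightarrow> awalk_verts u p ! j"
  shows "j = i + 2"
proof -
  obtain e e' where "e \<in> arcs G" "tail G e = awalk_verts u p ! i" "head G e = w"
    "e' \<in> arcs G" "tail G e' = w" "head G e' = awalk_verts u p ! j"
    using w by (auto simp: arcs_ends_conv)
  then have "awalk (awalk_verts u p ! i) [e, e'] (awalk_verts u p ! j)"
    using arc_implies_awalk[of e'] by (simp add: awalk_Cons_iff)
  from geodesic_segment_le[OF geo _ _ this] ij have "j - i \<le> 2"
    by simp
  moreover have "awalk u p v"
    using geo by (simp add: geodesic_def apath_def)
  then have "j \<noteq> Suc i"
    using awalk_verts_consecutive ij nadj by (metis Suc_le_lessD)
  ultimately show ?thesis
    using ij by simp
qed

text \<open>
  Any two distinct members of \<open>N\<close> on a common geodesic occupy positions that differ by exactly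
  two. Three positions cannot pairwise differ by two.
\<close>
lemma general_position_neighbours:
  assumes N: "N \<subseteq> verts G"
    and w: "\<And>x. x \<in> N \<Longrightarrow> x \<rightarrow> w" "\<And>x. x \<in> N \<Longrightarrow> w \<rightarrow> x"
    and indep: "\<And>x y. x \<in> N \<Longrightarrow> y \<in> N \<Longrightarrow> \<not> x \<rightarrow> y"
  shows "general_position G N"
  unfolding general_position_def
proof (intro conjI ballI impI notI)
  fix x y z
  assume xyz: "x \<in> N" "y \<in> N" "z \<in> N" "distinct [x, y, z]" and "on_common_geodesic G {x, y, z}"
  then obtain u p v where geo: "geodesic G u p v" and "{x, y, z} \<subseteq> set (awalk_verts u p)"
    unfolding on_common_geodesic_def by blast
  then obtain i j k where pos: "awalk_verts u p ! i = x" "awalk_verts u p ! j = y"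
      "awalk_verts u p ! k = z"
    and le: "i \<le> length p" "j \<le> length p" "k \<le> length p"
    by (auto simp: in_set_conv_nth length_awalk_verts less_Suc_eq_le)
  have apart: "m = n + 2 \<or> n = m + 2"
    if "m \<noteq> n" "m \<le> length p" "n \<le> length p"
      "awalk_verts u p ! m \<in> N" "awalk_verts u p ! n \<in> N" for m n
    using that geodesic_positions_of_neighbours[OF geo, of m n w]
      geodesic_positions_of_neighbours[OF geo, of n m w] w indep by (meson nat_neq_iff)
  have "i \<noteq> j" "j \<noteq> k" "i \<noteq> k"
    using pos xyz(4) by auto
  with apart[of i j] apart[of j k] apart[of i k] pos le xyz(1-3) show False
    by auto
qed (rule N)

end

section \<open>Four independent neighbours in a grid graph\<close>

text \<open>The grid is bipartite: an edge changes the parity of the sum of the coordinates.\<close>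
lemma grid_graph_arc_parity:
  assumes "grid_graph G" and "((a, b), (c, d)) \<in> parcs G"
  shows "even (a + b) \<noteq> even (c + d)"
proof -
  have "((a, b), (c, d)) \<in> parcs (infinite_path \<box> infinite_path)"
    using assms by (auto simp: grid_graph_def induced_subgraph_def)
  then have "a = c \<and> \<bar>b - d\<bar> = 1 \<or> b = d \<and> \<bar>a - c\<bar> = 1"
    by (auto simp: cartesian_product_def infinite_path_def)
  then show ?thesis
    by presburger
qed

lemma grid_graph_no_triangle:
  assumes "grid_graph G" and "(x, w) \<in> parcs G" and "(w, y) \<in> parcs G"
  shows "(x, y) \<notin> parcs G"
  using grid_graph_arc_parity[OF assms(1), of "fst x" "snd x" "fst w" "snd w"]
    grid_graph_arc_parity[OF assms(1), of "fst w" "snd w" "fst y" "snd y"]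
    grid_graph_arc_parity[OF assms(1), of "fst x" "snd x" "fst y" "snd y"] assms(2,3)
  by auto

text \<open>The vertex \<open>w\<close> is the image of the centre \<open>(1, 1)\<close> of \<open>P\<^sub>3 \<box> P\<^sub>3\<close>.\<close>
lemma contains_P3_P3_four_neighbours:
  fixes G :: "'a pair_pre_digraph"
  assumes "contains_subgraph G (path_graph 3 \<box> path_graph 3)"
  obtains N w where "N \<subseteq> pverts G" "card N = 4"
    "\<forall>x\<in>N. (x, w) \<in> parcs G \<and> (w, x) \<in> parcs G"
proof -
  let ?K = "path_graph 3 \<box> path_graph 3"
  let ?M = "{(0, 1), (2, 1), (1, 0), (1, 2)} :: (nat \<times> nat) set"
  from assms obtain H where sub: "subgraph (with_proj H) (with_proj G)"
    and "digraph_iso (with_proj ?K) (with_proj H)"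
    unfolding contains_subgraph_def by blast
  then obtain f where iso: "pre_digraph.digraph_isomorphism (with_proj ?K) f"
    and H: "with_proj H = app_iso f (with_proj ?K)"
    unfolding digraph_iso_def by blast
  have arcs: "(iso_verts f x, iso_verts f y) \<in> parcs G" if "(x, y) \<in> parcs ?K" for x y
  proof -
    have "iso_arcs f (x, y) \<in> parcs H"
      using arg_cong[OF H, of arcs] that by simp
    moreover have "fst (iso_arcs f (x, y)) = iso_verts f x" "snd (iso_arcs f (x, y)) = iso_verts f y"
      using arg_cong[OF H, of tail] arg_cong[OF H, of head] that
        pre_digraph.iso_verts_tail[OF iso, of "(x, y)"] pre_digraph.iso_verts_head[OF iso, of "(x, y)"]
      by simp_all
    ultimately show ?thesis
      using sub by (metis prod.collapse subgraph_def subsetD with_proj_simps(2))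
  qed
  have M: "?M \<subseteq> pverts ?K" "\<And>x. x \<in> ?M \<Longrightarrow> (x, (1, 1)) \<in> parcs ?K"
    "\<And>x. x \<in> ?M \<Longrightarrow> ((1, 1), x) \<in> parcs ?K"
    by (auto simp: cartesian_product_def path_graph_def)
  show ?thesis
  proof
    have "pverts H \<subseteq> pverts G" "pverts H = iso_verts f ` pverts ?K"
      using sub arg_cong[OF H, of verts] by (auto simp: subgraph_def)
    then show "iso_verts f ` ?M \<subseteq> pverts G"
      using M(1) by blast
    have "inj_on (iso_verts f) (pverts ?K)"
      using pre_digraph.digraph_isomorphism_inj_on_verts[OF iso] by simp
    then have "card (iso_verts f ` ?M) = card ?M"
      using M(1) by (intro card_image) (rule inj_on_subset)
    then show "card (iso_verts f ` ?M) = 4"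
      by simp
  next
    show "\<forall>x\<in>iso_verts f ` ?M.
        (x, iso_verts f (1, 1)) \<in> parcs G \<and> (iso_verts f (1, 1), x) \<in> parcs G"
      using arcs M(2,3) by blast
  qed
qed

section \<open>The general position number\<close>

theorem theorem3p1:
  fixes G :: "(int \<times> int) pair_pre_digraph"
  assumes "grid_graph G"
    and "contains_subgraph G (path_graph 3 \<box> path_graph 3)"
    and "monotone_geodesic_labeling (with_proj G) natural_labeling"
  shows "gp_number (with_proj G) = 4"
proof (rule antisym)
  have "enat (card S) \<le> 4" if "card S \<le> 4" for S :: "(int \<times> int) set"
    using that by (simp add: numeral_eq_enat)
  then show "gp_number (with_proj G) \<le> 4"
    unfolding gp_number_def using general_position_card_le_4[OF assms(3)]
    by (intro SUP_least) auto
next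
  interpret wf_digraph "with_proj G"
    using assms(1) by (simp add: grid_graph_def induced_subgraph_def subgraph_def)
  obtain N w where N: "N \<subseteq> pverts G" "card N = 4"
    and w: "\<forall>x\<in>N. (x, w) \<in> parcs G \<and> (w, x) \<in> parcs G"
    by (rule contains_P3_P3_four_neighbours[OF assms(2)])
  have "(x, y) \<notin> parcs G" if "x \<in> N" "y \<in> N" for x y
    using grid_graph_no_triangle[OF assms(1), of x w y] w that by simp
  then have "general_position (with_proj G) N"
    using N(1) w by (intro general_position_neighbours[where w = w]) simp_all
  then have "(if finite N then enat (card N) else \<infinity>) \<le> gp_number (with_proj G)"
    unfolding gp_number_def by (intro SUP_upper) simp
  moreover have "finite N"
    using N(2) by (simp add: card_ge_0_finite)
  ultimately show "4 \<le> gp_number (with_proj G)"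
    using N(2) by (simp add: numeral_eq_enat)
qed

end
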